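(* Let $m,n$ be positive integers, let $\gamma=(\gamma_{ij}:i\in[m],j\in[n])$ be a nonnegative vector, and let $\Pr$ be the probability measure on $[n]^{[m]}$ corresponding to $\gamma$, i.e. $\Pr(\sigma)\propto\prod_{i\in[m]}\gamma_{i,\sigma(i)}$. For $\sigma\in[n]^{[m]}$ and $j\in[n]$ let $B_j=|\sigma^{-1}(j)|$, and for $a,b\in\mathbb N^{n-1}$ and $k\in\mathbb N$ set $$p(k,a,b)=\Pr\bigl(B_n=k\mid B_j\in[a_j,b_j]\ \forall j\in[n-1]\bigr).$$ Then: (a) for each $k\in\mathbb N$, the ratio $\dfrac{p(k+1,a,b)}{p(k,a,b)}$ is nonincreasing in $(a,b)$ (that is, if $a\le a'$ and $b\le b'$ coordinatewise, then $\frac{p(k+1,a',b')}{p(k,a',b')}\le\frac{p(k+1,a,b)}{p(k,a,b)}$); (b) for each $k\ge1$ and all $a,b$, $\quad\dfrac{p(k+1,a,b)}{p(k,a,b)}\le\dfrac{k}{k+1}\cdot\dfrac{p(k,a,b)}{p(k-1,a,b)}$. Here nothing is claimed when one of the two ratios being compared is $0/0$, and $x/0=\infty$ when $x>0$.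
   Context: $\mathbb N=\{0,1,2,\dots\}$, $[m]=\{1,\dots,m\}$; $[n]^{[m]}$ is the set of functions $\sigma:[m]\to[n]$. It is assumed that $\prod_i\sum_j\gamma_{ij}>0$, so that $\Pr$ is well defined; under $\Pr$ the values $\sigma(1),\dots,\sigma(m)$ are independent (not necessarily identically distributed) with $\Pr(\sigma(i)=j)\propto\gamma_{ij}$. Only $(a,b)$ for which the conditioning event $\{B_j\in[a_j,b_j]\ \forall j\in[n-1]\}$ has positive probability are considered. *)

theory Defs
  imports "HOL-Probability.Probability"
begin

text \<open>
  The index sets \<open>[m]\<close> and \<open>[n]\<close> are \<open>{1..m}\<close> and \<open>{1..n}\<close>. The set of functions from \<open>[m]\<close>
  to \<open>[n]\<close> consists of the extensional functions, so that each function is represented once.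
  Vectors \<open>a, b\<close> indexed by \<open>[n - 1]\<close> are functions on \<open>nat\<close> whose values outside
  \<open>{1..n - 1}\<close> are never inspected; the same holds for \<open>\<gamma>\<close> outside \<open>[m] \<times> [n]\<close>.
\<close>

definition allocations :: "nat \<Rightarrow> nat \<Rightarrow> (nat \<Rightarrow> nat) set" where
  "allocations m n = {1..m} \<rightarrow>\<^sub>E {1..n}"

definition weight :: "nat \<Rightarrow> (nat \<Rightarrow> nat \<Rightarrow> real) \<Rightarrow> (nat \<Rightarrow> nat) \<Rightarrow> real" where
  "weight m \<gamma> \<sigma> = (\<Prod>i\<in>{1..m}. \<gamma> i (\<sigma> i))"

definition alloc_measure :: "nat \<Rightarrow> nat \<Rightarrow> (nat \<Rightarrow> nat \<Rightarrow> real) \<Rightarrow> (nat \<Rightarrow> nat) measure" where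
  "alloc_measure m n \<gamma> = point_measure (allocations m n)
     (\<lambda>\<sigma>. ennreal (weight m \<gamma> \<sigma> / (\<Sum>\<tau>\<in>allocations m n. weight m \<gamma> \<tau>)))"

definition occupation :: "nat \<Rightarrow> (nat \<Rightarrow> nat) \<Rightarrow> nat \<Rightarrow> nat" where
  "occupation m \<sigma> j = card {i \<in> {1..m}. \<sigma> i = j}"

definition box_event :: "nat \<Rightarrow> nat \<Rightarrow> (nat \<Rightarrow> nat) \<Rightarrow> (nat \<Rightarrow> nat) \<Rightarrow> (nat \<Rightarrow> nat) \<Rightarrow> bool" where
  "box_event m n a b \<sigma> \<longleftrightarrow> (\<forall>j\<in>{1..n - 1}. occupation m \<sigma> j \<in> {a j..b j})"

definition cond_occ ::
  "nat \<Rightarrow> nat \<Rightarrow> (nat \<Rightarrow> nat \<Rightarrow> real) \<Rightarrow> nat \<Rightarrow> (nat \<Rightarrow> nat) \<Rightarrow> (nat \<Rightarrow> nat) \<Rightarrow> real" where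
  "cond_occ m n \<gamma> k a b =
     \<P>(\<sigma> in alloc_measure m n \<gamma>. occupation m \<sigma> n = k \<bar> box_event m n a b \<sigma>)"

definition admissible ::
  "nat \<Rightarrow> nat \<Rightarrow> (nat \<Rightarrow> nat \<Rightarrow> real) \<Rightarrow> (nat \<Rightarrow> nat) \<Rightarrow> (nat \<Rightarrow> nat) \<Rightarrow> bool" where
  "admissible m n \<gamma> a b \<longleftrightarrow> \<P>(\<sigma> in alloc_measure m n \<gamma>. box_event m n a b \<sigma>) > 0"

text \<open>
  Ratios of nonnegative reals are taken in \<^typ>\<open>ennreal\<close>, where \<open>x / 0 = \<infinity>\<close> for \<open>x > 0\<close>.
  There \<open>0 / 0\<close> evaluates to \<open>0\<close>, so that case has to be excluded explicitly.
\<close>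

definition ratio :: "real \<Rightarrow> real \<Rightarrow> ennreal" where
  "ratio x y = ennreal x / ennreal y"

definition determinate :: "real \<Rightarrow> real \<Rightarrow> bool" where
  "determinate x y \<longleftrightarrow> \<not> (x = 0 \<and> y = 0)"

lemma ratio_zero_right: "x > 0 \<Longrightarrow> ratio x 0 = \<infinity>"
  by (simp add: ratio_def ennreal_divide_eq_top_iff)

lemma sum_weight: "(\<Sum>\<tau>\<in>allocations m n. weight m \<gamma> \<tau>) = (\<Prod>i\<in>{1..m}. \<Sum>j\<in>{1..n}. \<gamma> i j)"
  unfolding allocations_def weight_def by (rule prod_sum_PiE[symmetric]) auto

lemma prob_space_alloc_measure:
  assumes nonneg: "\<And>i j. i \<in> {1..m} \<Longrightarrow> j \<in> {1..n} \<Longrightarrow> \<gamma> i j \<ge> 0"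
    and pos: "(\<Prod>i\<in>{1..m}. \<Sum>j\<in>{1..n}. \<gamma> i j) > 0"
  shows "prob_space (alloc_measure m n \<gamma>)"
proof -
  have fin: "finite (allocations m n)"
    unfolding allocations_def by (rule finite_PiE) auto
  have w: "weight m \<gamma> \<sigma> \<ge> 0" if "\<sigma> \<in> allocations m n" for \<sigma>
    unfolding weight_def using that nonneg
    by (intro prod_nonneg) (auto simp: allocations_def PiE_iff)
  let ?Z = "\<Sum>\<tau>\<in>allocations m n. weight m \<gamma> \<tau>"
  have Z: "?Z > 0" using pos by (simp add: sum_weight)
  have "(\<Sum>\<sigma>\<in>allocations m n. ennreal (weight m \<gamma> \<sigma> / ?Z))
      = ennreal (\<Sum>\<sigma>\<in>allocations m n. weight m \<gamma> \<sigma> / ?Z)"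
    using w Z by (intro sum_ennreal) auto
  also have "\<dots> = 1"
    using Z by (simp add: sum_divide_distrib[symmetric])
  finally show ?thesis
    unfolding alloc_measure_def by (intro prob_space_point_measure fin) auto
qed

end

theory Submission
  imports Defs
begin

text \<open>
  Let \<open>N T B\<close> be the total weight of the allocations of the balls in \<open>T\<close> whose occupation numbers
  lie in a box \<open>B\<close>. Induction on \<open>T\<close> shows that for boxes \<open>B \<le> B'\<close> and every urn \<open>x\<close>
  \<open>N T B' * N T (B - e\<^sub>x) \<le> N T B * N T (B' - e\<^sub>x)\<close>.
  Conditioning on the urn of a ball \<open>i\<close>, the inequality for \<open>T - {i}\<close> says that
  \<open>N T B / N (T - {i}) B\<close> is nondecreasing in \<open>B\<close>. Counting the pairs of an allocation with \<open>z\<close>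
  balls in \<open>x\<close> and one of these balls gives \<open>z * N T (B, x = z) = (\<Sum>i\<in>T. \<gamma> i x * N (T - {i}) (B, x = z - 1))\<close>,
  so for \<open>y < z\<close> and boxes \<open>B \<le> B'\<close> of the other urns monotonicity yields
  \<open>z * N T (B, x = y) * N T (B', x = z) \<le> (y + 1) * N T (B, x = y + 1) * N T (B', x = z - 1)\<close>.
  Both parts of the theorem are special cases of this, and summing over \<open>y\<close> and \<open>z\<close> closes the induction.
\<close>

section \<open>Exchange inequalities for two sequences on the integers\<close>

text \<open>Here \<open>exch\<close> is applied \<open>d\<close> times. The last application starts
  at \<open>y + int d - 1\<close>, and the bound on \<open>y + int d\<close> keeps that index below
  its partner.\<close>

lemma exchange_chain:
  fixes P Q :: "int \<Rightarrow> real"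
  assumes exch: "\<And>y z. y < z \<Longrightarrow> P y * Q z \<le> P (y + 1) * Q (z - 1)"
    and "2 * (y + int d) \<le> c + 1"
  shows "P y * Q (c - y) \<le> P (y + int d) * Q (c - (y + int d))"
  using assms(2)
proof (induction d)
  case (Suc d)
  have "P y * Q (c - y) \<le> P (y + int d) * Q (c - (y + int d))"
    using Suc by simp
  also have "\<dots> \<le> P (y + int d + 1) * Q (c - (y + int d) - 1)"
    using Suc.prems by (intro exch) auto
  finally show ?case by (simp add: algebra_simps)
qed simp

text \<open>For adjacent indices \<open>exch\<close> compares the growth ratios:
  \<open>Q (w + 1) / Q w\<close> is at most \<open>P (w + 1) / P w\<close>. Multiplying over
  \<open>w\<close> swaps the mirror-image indices \<open>u\<close> and \<open>u + int d\<close>,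
  which carries the comparison across the middle, where \<open>exchange_chain\<close> stops.\<close>

lemma exchange_ratio:
  fixes P Q :: "int \<Rightarrow> real"
  assumes nonneg: "\<And>z. P z \<ge> 0" "\<And>z. Q z \<ge> 0"
    and exch: "\<And>y z. y < z \<Longrightarrow> P y * Q z \<le> P (y + 1) * Q (z - 1)"
  shows "P u * Q (u + int d) \<le> P (u + int d) * Q u"
proof (cases "P u * Q (u + int d) = 0")
  case True
  then show ?thesis using nonneg by (metis mult_nonneg_nonneg)
next
  case False
  then have pos: "P u > 0" "Q (u + int d) > 0"
    using nonneg by (auto simp: less_le)
  \<comment> \<open>The exchange inequality propagates positivity upwards from \<open>P u\<close>, so the telescoping
    product of ratios below never divides by zero.\<close>
  have Ppos: "P (u + int e) > 0" if "e \<le> d" for e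
    using that
  proof (induction e)
    case (Suc e)
    then have "0 < P (u + int e) * Q (u + int d)"
      using pos by simp
    also have "\<dots> \<le> P (u + int e + 1) * Q (u + int d - 1)"
      using Suc.prems by (intro exch) auto
    finally have "P (u + int e + 1) \<noteq> 0" by auto
    then show ?case
      using nonneg(1)[of "u + int e + 1"] by (simp add: algebra_simps less_le)
  qed (use pos in simp)
  have "P u * Q (u + int e) \<le> P (u + int e) * Q u" if "e \<le> d" for e
    using that
  proof (induction e)
    case (Suc e)
    let ?w = "u + int e"
    have "P ?w * (P u * Q (?w + 1)) = P u * (P ?w * Q (?w + 1))" by simp
    also have "\<dots> \<le> P u * (P (?w + 1) * Q (?w + 1 - 1))"
      by (intro mult_left_mono exch nonneg) auto
    also have "\<dots> = P (?w + 1) * (P u * Q ?w)" by simp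
    also have "\<dots> \<le> P (?w + 1) * (P ?w * Q u)"
      using Suc by (intro mult_left_mono nonneg) auto
    finally have "P ?w * (P u * Q (?w + 1)) \<le> P ?w * (P (?w + 1) * Q u)"
      by (simp add: ac_simps)
    then show ?case
      using Ppos[of e] Suc.prems by (simp add: algebra_simps)
  qed simp
  then show ?thesis by simp
qed

text \<open>Up to the middle of the antidiagonal \<open>y + z = c\<close> the chain suffices. If
  \<open>Y\<close> lies beyond it, the chain goes to the mirror image \<open>c - Y\<close>, which is
  at least \<open>y\<close>, and \<open>exchange_ratio\<close> swaps the two indices.\<close>

lemma exchange_extremes:
  fixes P Q :: "int \<Rightarrow> real"
  assumes nonneg: "\<And>z. P z \<ge> 0" "\<And>z. Q z \<ge> 0"
    and exch: "\<And>y z. y < z \<Longrightarrow> P y * Q z \<le> P (y + 1) * Q (z - 1)"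
    and "y \<le> Y" "y + Y \<le> c"
  shows "P y * Q (c - y) \<le> P Y * Q (c - Y)"
proof (cases "2 * Y \<le> c + 1")
  case True
  show ?thesis
    using exchange_chain[of P Q y "nat (Y - y)" c] exch True \<open>y \<le> Y\<close> by simp
next
  case False
  have "P y * Q (c - y) \<le> P (c - Y) * Q (c - (c - Y))"
    using exchange_chain[of P Q y "nat (c - Y - y)" c] exch False assms(4,5) by simp
  also have "\<dots> \<le> P Y * Q (c - Y)"
    using exchange_ratio[of P Q "c - Y" "nat (2 * Y - c)"] nonneg exch False by simp
  finally show ?thesis .
qed

text \<open>The ranges share \<open>{L + 1..U}\<close>, so only the end terms differ.\<close>

lemma sum_int_shift_le:
  fixes g :: "int \<Rightarrow> real"
  assumes "L \<le> U \<Longrightarrow> g L \<le> g (U + 1)"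
  shows "sum g {L..U} \<le> sum g {L + 1..U + 1}"
proof (cases "L \<le> U")
  case True
  have "{L..U} = insert L {L + 1..U}" "{L + 1..U + 1} = insert (U + 1) {L + 1..U}"
    using True by auto
  then show ?thesis using assms True by simp
qed simp

text \<open>Pairs are grouped by their sum \<open>c\<close>. Any range \<open>lo..hi\<close>
  containing all these sums will do, since an antidiagonal that misses the rectangle has an empty
  inner range.\<close>

lemma sum_product_antidiagonals:
  fixes P Q :: "int \<Rightarrow> real"
  assumes "lo \<le> p + r" "q + s \<le> hi"
  shows "sum P {p..q} * sum Q {r..s}
    = (\<Sum>c=lo..hi. \<Sum>y=max p (c - s)..min q (c - r). P y * Q (c - y))"
proof -
  have "sum P {p..q} * sum Q {r..s} = (\<Sum>(y, z)\<in>{p..q} \<times> {r..s}. P y * Q z)"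
    by (simp add: sum_product sum.cartesian_product)
  also have "\<dots> = (\<Sum>(c, y)\<in>(SIGMA c:{lo..hi}. {max p (c - s)..min q (c - r)}). P y * Q (c - y))"
    by (rule sum.reindex_bij_witness[of _ "\<lambda>(c, y). (y, c - y)" "\<lambda>(y, z). (y + z, y)"])
      (use assms in auto)
  also have "\<dots> = (\<Sum>c=lo..hi. \<Sum>y=max p (c - s)..min q (c - r). P y * Q (c - y))"
    by (rule sum.Sigma[symmetric]) auto
  finally show ?thesis .
qed

text \<open>Both products run over the same antidiagonals, and on each one the range of
  \<open>y\<close> on the right is that on the left moved up by one.\<close>

lemma exchange_intervals:
  fixes P Q :: "int \<Rightarrow> real"
  assumes nonneg: "\<And>z. P z \<ge> 0" "\<And>z. Q z \<ge> 0"
    and exch: "\<And>y z. y < z \<Longrightarrow> P y * Q z \<le> P (y + 1) * Q (z - 1)"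
    and "s \<le> s'" "t \<le> t'"
  shows "sum P {s - 1..t - 1} * sum Q {s'..t'} \<le> sum P {s..t} * sum Q {s' - 1..t' - 1}"
proof -
  let ?I = "{s + s' - 1..t + t' - 1}"
  let ?L = "\<lambda>c. max (s - 1) (c - t')" and ?U = "\<lambda>c. min (t - 1) (c - s')"
  have "sum P {s - 1..t - 1} * sum Q {s'..t'}
      = (\<Sum>c\<in>?I. \<Sum>y=?L c..?U c. P y * Q (c - y))"
    by (rule sum_product_antidiagonals) auto
  \<comment> \<open>The indices compared are \<open>?L c\<close> and \<open>?U c + 1\<close>. Their
    sum is at most \<open>c\<close>: by \<open>s \<le> s'\<close> if the maximum is
    \<open>s - 1\<close>, by \<open>t \<le> t'\<close> if it is \<open>c - t'\<close>.\<close>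
  also have "\<dots> \<le> (\<Sum>c\<in>?I. \<Sum>y=?L c + 1..?U c + 1. P y * Q (c - y))"
    by (intro sum_mono sum_int_shift_le exchange_extremes nonneg exch) (use assms(4,5) in auto)
  also have "\<dots> = (\<Sum>c\<in>?I. \<Sum>y=max s (c - (t' - 1))..min t (c - (s' - 1)). P y * Q (c - y))"
    by (intro sum.cong arg_cong2[where f = atLeastAtMost]) auto
  also have "\<dots> = sum P {s..t} * sum Q {s' - 1..t' - 1}"
    by (rule sum_product_antidiagonals[symmetric]) auto
  finally show ?thesis .
qed

section \<open>Box weights and their recursions over the balls\<close>

definition in_box :: "'b set \<Rightarrow> 'a set \<Rightarrow> ('b \<Rightarrow> int) \<Rightarrow> ('b \<Rightarrow> int) \<Rightarrow> ('a \<Rightarrow> 'b) \<Rightarrow> bool" where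
  "in_box J T l h \<sigma> \<longleftrightarrow> (\<forall>j\<in>J. int (card {i \<in> T. \<sigma> i = j}) \<in> {l j..h j})"

text \<open>
  Bounds are integers so that boxes can be shifted down past 0 without truncation.
\<close>

definition box_weight ::
  "('a \<Rightarrow> 'b \<Rightarrow> real) \<Rightarrow> 'b set \<Rightarrow> 'a set \<Rightarrow> ('b \<Rightarrow> int) \<Rightarrow> ('b \<Rightarrow> int) \<Rightarrow> real" where
  "box_weight \<gamma> J T l h =
     (\<Sum>\<sigma>\<in>T \<rightarrow>\<^sub>E J. of_bool (in_box J T l h \<sigma>) * (\<Prod>i\<in>T. \<gamma> i (\<sigma> i)))"

lemma box_weight_nonneg:
  assumes "\<And>i j. i \<in> T \<Longrightarrow> j \<in> J \<Longrightarrow> \<gamma> i j \<ge> 0"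
  shows "box_weight \<gamma> J T l h \<ge> 0"
  unfolding box_weight_def using assms
  by (intro sum_nonneg mult_nonneg_nonneg prod_nonneg) (auto simp: PiE_iff)

lemma box_weight_split:
  assumes "finite J" "finite T" "x \<in> J"
  shows "box_weight \<gamma> J T l h = (\<Sum>z=l x..h x. box_weight \<gamma> J T (l(x := z)) (h(x := z)))"
proof -
  have "of_bool (in_box J T l h \<sigma>) =
      (\<Sum>z=l x..h x. of_bool (in_box J T (l(x := z)) (h(x := z)) \<sigma>) :: real)" for \<sigma>
  proof -
    let ?c = "int (card {i \<in> T. \<sigma> i = x})"
    have *: "in_box J T (l(x := z)) (h(x := z)) \<sigma> \<longleftrightarrow>
        ?c = z \<and> in_box (J - {x}) T l h \<sigma>" for z
      using \<open>x \<in> J\<close> by (auto simp: in_box_def)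
    have "in_box J T l h \<sigma> \<longleftrightarrow> ?c \<in> {l x..h x} \<and> in_box (J - {x}) T l h \<sigma>"
      using \<open>x \<in> J\<close> by (auto simp: in_box_def)
    then show ?thesis
      by (cases "in_box (J - {x}) T l h \<sigma>")
        (simp_all add: * of_bool_def sum.delta')
  qed
  then show ?thesis
    unfolding box_weight_def by (simp add: sum_distrib_right sum.swap[of _ "T \<rightarrow>\<^sub>E J"])
qed

lemma sum_PiE_fiber:
  fixes f :: "('a \<Rightarrow> 'b) \<Rightarrow> real"
  assumes "finite J" "finite T" "i \<notin> T" "j \<in> J"
  shows "(\<Sum>\<sigma>\<in>insert i T \<rightarrow>\<^sub>E J. of_bool (\<sigma> i = j) * f \<sigma>) = (\<Sum>\<tau>\<in>T \<rightarrow>\<^sub>E J. f (\<tau>(i := j)))"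
proof -
  have fin: "finite (insert i T \<rightarrow>\<^sub>E J)"
    using assms by (intro finite_PiE) auto
  have "(\<Sum>\<sigma>\<in>insert i T \<rightarrow>\<^sub>E J. of_bool (\<sigma> i = j) * f \<sigma>) = (\<Sum>\<sigma>\<in>{\<sigma> \<in> insert i T \<rightarrow>\<^sub>E J. \<sigma> i = j}. f \<sigma>)"
    by (rule sum.mono_neutral_cong_right) (use fin in auto)
  also have "\<dots> = (\<Sum>\<tau>\<in>T \<rightarrow>\<^sub>E J. f (\<tau>(i := j)))"
    \<comment> \<open>Forgetting ball \<open>i\<close> resets its value to \<open>undefined\<close>,
      as extensionality on \<open>T\<close> demands.\<close>
    by (rule sum.reindex_bij_witness[of _ "\<lambda>\<tau>. \<tau>(i := j)" "\<lambda>\<sigma>. \<sigma>(i := undefined)"])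
      (use assms in \<open>auto simp: PiE_iff extensional_def fun_eq_iff\<close>)
  finally show ?thesis .
qed

text \<open>Ball \<open>i\<close> in urn \<open>j\<close> contributes the factor
  \<open>\<gamma> i j\<close> and one occupant of \<open>j\<close>, so the other balls face bounds
  lowered by one in \<open>j\<close> alone.\<close>

lemma box_weight_fiber:
  assumes "finite J" "finite T" "i \<in> T" "j \<in> J"
  shows "(\<Sum>\<sigma>\<in>T \<rightarrow>\<^sub>E J. of_bool (\<sigma> i = j) * (of_bool (in_box J T l h \<sigma>) * (\<Prod>i\<in>T. \<gamma> i (\<sigma> i))))
    = \<gamma> i j * box_weight \<gamma> J (T - {i}) (l(j := l j - 1)) (h(j := h j - 1))"
proof -
  let ?T = "T - {i}"
  have T: "T = insert i ?T" "finite ?T" "i \<notin> ?T"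
    using assms by auto
  have box: "in_box J T l h (\<tau>(i := j)) \<longleftrightarrow> in_box J ?T (l(j := l j - 1)) (h(j := h j - 1)) \<tau>" for \<tau>
  proof -
    have "{i' \<in> T. (\<tau>(i := j)) i' = j} = insert i {i' \<in> ?T. \<tau> i' = j}"
      using assms by auto
    then have "card {i' \<in> T. (\<tau>(i := j)) i' = j} = Suc (card {i' \<in> ?T. \<tau> i' = j})"
      using T by simp
    moreover have "{i' \<in> T. (\<tau>(i := j)) i' = j'} = {i' \<in> ?T. \<tau> i' = j'}" if "j' \<noteq> j" for j'
      using that by auto
    ultimately have "int (card {i' \<in> T. (\<tau>(i := j)) i' = j'}) =
        int (card {i' \<in> ?T. \<tau> i' = j'}) + of_bool (j' = j)" for j'
      by (cases "j' = j") simp_all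
    then show ?thesis
      unfolding in_box_def by (intro ball_cong) auto
  qed
  have pr: "(\<Prod>i'\<in>T. \<gamma> i' ((\<tau>(i := j)) i')) = \<gamma> i j * (\<Prod>i'\<in>?T. \<gamma> i' (\<tau> i'))" for \<tau>
    by (subst prod.remove[OF \<open>finite T\<close> \<open>i \<in> T\<close>]) (auto intro!: prod.cong)
  have "(\<Sum>\<sigma>\<in>T \<rightarrow>\<^sub>E J. of_bool (\<sigma> i = j) * (of_bool (in_box J T l h \<sigma>) * (\<Prod>i\<in>T. \<gamma> i (\<sigma> i))))
     = (\<Sum>\<tau>\<in>?T \<rightarrow>\<^sub>E J. of_bool (in_box J T l h (\<tau>(i := j))) * (\<Prod>i'\<in>T. \<gamma> i' ((\<tau>(i := j)) i')))"
    using sum_PiE_fiber[OF \<open>finite J\<close> T(2,3) \<open>j \<in> J\<close>] T(1)[symmetric] by simp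
  also have "\<dots> = \<gamma> i j * box_weight \<gamma> J ?T (l(j := l j - 1)) (h(j := h j - 1))"
    unfolding box pr box_weight_def by (simp add: sum_distrib_left ac_simps)
  finally show ?thesis .
qed

lemma box_weight_remove:
  assumes "finite J" "finite T" "i \<in> T"
  shows "box_weight \<gamma> J T l h =
    (\<Sum>j\<in>J. \<gamma> i j * box_weight \<gamma> J (T - {i}) (l(j := l j - 1)) (h(j := h j - 1)))"
proof -
  have "(\<Sum>j\<in>J. of_bool (\<sigma> i = j)) = (1 :: real)" if "\<sigma> \<in> T \<rightarrow>\<^sub>E J" for \<sigma>
  proof -
    have "\<sigma> i \<in> J" using that \<open>i \<in> T\<close> by auto
    then show ?thesis using \<open>finite J\<close> by (simp add: of_bool_def sum.delta')
  qed
  then have "box_weight \<gamma> J T l h = (\<Sum>\<sigma>\<in>T \<rightarrow>\<^sub>E J. (\<Sum>j\<in>J. of_bool (\<sigma> i = j)) *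
      (of_bool (in_box J T l h \<sigma>) * (\<Prod>i\<in>T. \<gamma> i (\<sigma> i))))"
    unfolding box_weight_def by (intro sum.cong) auto
  also have "\<dots> = (\<Sum>j\<in>J. \<Sum>\<sigma>\<in>T \<rightarrow>\<^sub>E J. of_bool (\<sigma> i = j) *
      (of_bool (in_box J T l h \<sigma>) * (\<Prod>i\<in>T. \<gamma> i (\<sigma> i))))"
    by (subst sum.swap) (simp add: sum_distrib_right)
  finally show ?thesis
    using assms by (simp add: box_weight_fiber)
qed

text \<open>An allocation meeting the pinned box has exactly \<open>z\<close> balls in
  \<open>x\<close>, so the right side counts it \<open>z\<close> times. Every other allocation
  contributes zero to both sides, which also covers negative \<open>z\<close>.\<close>

lemma box_weight_count:
  assumes "finite J" "finite T" "x \<in> J"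
  shows "of_int z * box_weight \<gamma> J T (l(x := z)) (h(x := z)) =
    (\<Sum>i\<in>T. \<gamma> i x * box_weight \<gamma> J (T - {i}) (l(x := z - 1)) (h(x := z - 1)))"
proof -
  let ?w = "\<lambda>\<sigma>. of_bool (in_box J T (l(x := z)) (h(x := z)) \<sigma>) * (\<Prod>i\<in>T. \<gamma> i (\<sigma> i))"
  have count: "of_int z * ?w \<sigma> = (\<Sum>i\<in>T. of_bool (\<sigma> i = x) * ?w \<sigma>)" for \<sigma>
  proof -
    have "(\<Sum>i\<in>T. of_bool (\<sigma> i = x)) = real (card {i \<in> T. \<sigma> i = x})"
      using \<open>finite T\<close> by (simp add: sum_of_bool_eq Int_def)
    moreover have "in_box J T (l(x := z)) (h(x := z)) \<sigma> \<Longrightarrow> z = int (card {i \<in> T. \<sigma> i = x})"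
      using \<open>x \<in> J\<close> by (auto simp: in_box_def)
    ultimately show ?thesis
      by (auto simp: sum_distrib_right[symmetric])
  qed
  have "of_int z * box_weight \<gamma> J T (l(x := z)) (h(x := z)) =
      (\<Sum>\<sigma>\<in>T \<rightarrow>\<^sub>E J. \<Sum>i\<in>T. of_bool (\<sigma> i = x) * ?w \<sigma>)"
    unfolding box_weight_def sum_distrib_left count ..
  also have "\<dots> = (\<Sum>i\<in>T. \<Sum>\<sigma>\<in>T \<rightarrow>\<^sub>E J. of_bool (\<sigma> i = x) * ?w \<sigma>)"
    by (rule sum.swap)
  also have "\<dots> = (\<Sum>i\<in>T. \<gamma> i x * box_weight \<gamma> J (T - {i}) (l(x := z - 1)) (h(x := z - 1)))"
    using assms by (intro sum.cong) (simp_all add: box_weight_fiber)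
  finally show ?thesis .
qed

section \<open>Monotonicity in the box, by induction on the set of balls\<close>

definition box_le :: "'b set \<Rightarrow> ('b \<Rightarrow> int) \<Rightarrow> ('b \<Rightarrow> int) \<Rightarrow> ('b \<Rightarrow> int) \<Rightarrow> ('b \<Rightarrow> int) \<Rightarrow> bool" where
  "box_le J l h l' h' \<longleftrightarrow> (\<forall>j\<in>J. l j \<le> l' j \<and> h j \<le> h' j)"

text \<open>The quotient of the weight of the box shifted down in \<open>x\<close> by the weight of
  the box is nondecreasing in the box. Cross-multiplication keeps this meaningful when weights
  vanish.\<close>

definition shift_property :: "('a \<Rightarrow> 'b \<Rightarrow> real) \<Rightarrow> 'b set \<Rightarrow> 'a set \<Rightarrow> bool" where
  "shift_property \<gamma> J T \<longleftrightarrow> (\<forall>x\<in>J. \<forall>l h l' h'. box_le J l h l' h' \<longrightarrow>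
     box_weight \<gamma> J T l' h' * box_weight \<gamma> J T (l(x := l x - 1)) (h(x := h x - 1))
     \<le> box_weight \<gamma> J T l h * box_weight \<gamma> J T (l'(x := l' x - 1)) (h'(x := h' x - 1)))"

text \<open>After expanding the weights for \<open>T\<close> by the urn \<open>j\<close> of ball
  \<open>i\<close>, each summand is an instance of \<open>shift_property\<close> for the remaining
  balls.\<close>

lemma box_weight_remove_mono:
  assumes fin: "finite J" "finite T" and "i \<in> T"
    and nonneg: "\<And>j. j \<in> J \<Longrightarrow> \<gamma> i j \<ge> 0"
    and shift: "shift_property \<gamma> J (T - {i})"
    and le: "box_le J l h l' h'"
  shows "box_weight \<gamma> J (T - {i}) l' h' * box_weight \<gamma> J T l h
    \<le> box_weight \<gamma> J (T - {i}) l h * box_weight \<gamma> J T l' h'"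
proof -
  let ?N = "box_weight \<gamma> J (T - {i})"
  have "\<gamma> i j * (?N l' h' * ?N (l(j := l j - 1)) (h(j := h j - 1)))
      \<le> \<gamma> i j * (?N l h * ?N (l'(j := l' j - 1)) (h'(j := h' j - 1)))" if "j \<in> J" for j
    using shift le that unfolding shift_property_def by (intro mult_left_mono nonneg) auto
  then show ?thesis
    unfolding box_weight_remove[OF fin \<open>i \<in> T\<close>] sum_distrib_left
    by (intro sum_mono) (simp add: ac_simps)
qed

lemma box_weight_exchange_aux:
  assumes fin: "finite J" "finite T" and "x \<in> J"
    and nonneg: "\<And>i j. i \<in> T \<Longrightarrow> j \<in> J \<Longrightarrow> \<gamma> i j \<ge> 0"
    and shift: "\<And>i. i \<in> T \<Longrightarrow> shift_property \<gamma> J (T - {i})"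
    and le: "box_le (J - {x}) l h l' h'" and "y < z"
  shows "of_int z * (box_weight \<gamma> J T (l(x := y)) (h(x := y)) * box_weight \<gamma> J T (l'(x := z)) (h'(x := z)))
    \<le> of_int (y + 1) * (box_weight \<gamma> J T (l(x := y + 1)) (h(x := y + 1))
        * box_weight \<gamma> J T (l'(x := z - 1)) (h'(x := z - 1)))"
proof -
  let ?P = "\<lambda>T y. box_weight \<gamma> J T (l(x := y)) (h(x := y))"
  let ?Q = "\<lambda>T z. box_weight \<gamma> J T (l'(x := z)) (h'(x := z))"
  \<comment> \<open>Since \<open>y < z\<close> means \<open>y \<le> z - 1\<close>, the pinned boxes
    are ordered in coordinate \<open>x\<close> too.\<close>
  have "box_le J (l(x := y)) (h(x := y)) (l'(x := z - 1)) (h'(x := z - 1))"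
    using le \<open>y < z\<close> by (auto simp: box_le_def)
  then have mono: "?Q (T - {i}) (z - 1) * ?P T y \<le> ?P (T - {i}) y * ?Q T (z - 1)" if "i \<in> T" for i
    using that by (intro box_weight_remove_mono fin nonneg shift)
  have "of_int z * (?P T y * ?Q T z) = ?P T y * (of_int z * ?Q T z)"
    by simp
  also have "\<dots> = (\<Sum>i\<in>T. \<gamma> i x * (?Q (T - {i}) (z - 1) * ?P T y))"
    unfolding box_weight_count[OF fin \<open>x \<in> J\<close>] by (simp add: sum_distrib_left ac_simps)
  also have "\<dots> \<le> (\<Sum>i\<in>T. \<gamma> i x * (?P (T - {i}) y * ?Q T (z - 1)))"
    using \<open>x \<in> J\<close> by (intro sum_mono mult_left_mono mono nonneg)
  \<comment> \<open>The form \<open>y + 1 - 1\<close> lets \<open>box_weight_count\<close> be read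
    backwards at \<open>y + 1\<close>.\<close>
  also have "\<dots> = (\<Sum>i\<in>T. \<gamma> i x * ?P (T - {i}) (y + 1 - 1)) * ?Q T (z - 1)"
    by (simp add: sum_distrib_left sum_distrib_right ac_simps)
  also have "\<dots> = of_int (y + 1) * (?P T (y + 1) * ?Q T (z - 1))"
    unfolding box_weight_count[OF fin \<open>x \<in> J\<close>, symmetric] by simp
  finally show ?thesis .
qed

lemma box_weight_neg:
  assumes "x \<in> J" "z < 0"
  shows "box_weight \<gamma> J T (l(x := z)) (h(x := z)) = 0"
proof -
  have "\<not> in_box J T (l(x := z)) (h(x := z)) \<sigma>" for \<sigma>
    using assms by (auto simp: in_box_def intro!: bexI[of _ x])
  then show ?thesis by (simp add: box_weight_def)
qed

text \<open>Shifting changes a box only in urn \<open>x\<close>, so all four weights are interval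
  sums of the two sequences \<open>?P\<close> and \<open>?Q\<close>. The induction hypothesis for
  \<open>T - {i}\<close> yields their exchange inequality.\<close>

lemma shift_property_holds:
  assumes "finite J" "finite T"
    and nonneg: "\<And>i j. i \<in> T \<Longrightarrow> j \<in> J \<Longrightarrow> \<gamma> i j \<ge> 0"
  shows "shift_property \<gamma> J T"
  using \<open>finite T\<close> nonneg
proof (induction T rule: finite_psubset_induct)
  case (psubset T)
  have smaller: "shift_property \<gamma> J (T - {i})" if "i \<in> T" for i
    using that by (intro psubset.IH) (auto intro: psubset.prems)
  have N: "box_weight \<gamma> J T l h \<ge> 0" for l h
    by (intro box_weight_nonneg psubset.prems)
  show ?case
    unfolding shift_property_def
  proof (intro ballI allI impI)
    fix x l h l' h'
    assume "x \<in> J" and le: "box_le J l h l' h'"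
    let ?P = "\<lambda>y. box_weight \<gamma> J T (l(x := y)) (h(x := y))"
    let ?Q = "\<lambda>z. box_weight \<gamma> J T (l'(x := z)) (h'(x := z))"
    have exch: "?P y * ?Q z \<le> ?P (y + 1) * ?Q (z - 1)" if "y < z" for y z
    \<comment> \<open>For negative \<open>y\<close> the left side vanishes; otherwise
      \<open>z\<close> is positive and can be cancelled.\<close>
    proof (cases "y < 0")
      case True
      then show ?thesis by (simp add: box_weight_neg[OF \<open>x \<in> J\<close>] N)
    next
      case False
      have "box_le (J - {x}) l h l' h'"
        using le by (auto simp: box_le_def)
      then have "of_int z * (?P y * ?Q z) \<le> of_int (y + 1) * (?P (y + 1) * ?Q (z - 1))"
        using that \<open>x \<in> J\<close>
        by (intro box_weight_exchange_aux \<open>finite J\<close> psubset.hyps psubset.prems smaller)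
      \<comment> \<open>Weakening \<open>y + 1\<close> to \<open>z\<close> gives the exchange
        inequality without factors.\<close>
      also have "\<dots> \<le> of_int z * (?P (y + 1) * ?Q (z - 1))"
        using that by (intro mult_right_mono mult_nonneg_nonneg N) linarith
      finally show ?thesis
        using that False by (simp add: mult_le_cancel_left_pos)
    qed
    have split: "box_weight \<gamma> J T (l(x := p)) (h(x := q)) = (\<Sum>z=p..q. box_weight \<gamma> J T (l(x := z)) (h(x := z)))"
      for l h p q
      by (subst box_weight_split[OF \<open>finite J\<close> \<open>finite T\<close> \<open>x \<in> J\<close>]) simp
    have "sum ?P {l x - 1..h x - 1} * sum ?Q {l' x..h' x} \<le> sum ?P {l x..h x} * sum ?Q {l' x - 1..h' x - 1}"
      by (rule exchange_intervals) (use exch N le \<open>x \<in> J\<close> in \<open>auto simp: box_le_def\<close>)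
    then show "box_weight \<gamma> J T l' h' * box_weight \<gamma> J T (l(x := l x - 1)) (h(x := h x - 1))
       \<le> box_weight \<gamma> J T l h * box_weight \<gamma> J T (l'(x := l' x - 1)) (h'(x := h' x - 1))"
      unfolding split[symmetric] by (simp add: mult.commute)
  qed
qed

text \<open>The shift property, now known for all finite sets of balls, discharges the hypothesis of
  the auxiliary version.\<close>

lemma box_weight_exchange:
  assumes "finite J" "finite T" "x \<in> J"
    and nonneg: "\<And>i j. i \<in> T \<Longrightarrow> j \<in> J \<Longrightarrow> \<gamma> i j \<ge> 0"
    and "box_le (J - {x}) l h l' h'" and "y < z"
  shows "of_int z * (box_weight \<gamma> J T (l(x := y)) (h(x := y)) * box_weight \<gamma> J T (l'(x := z)) (h'(x := z)))
    \<le> of_int (y + 1) * (box_weight \<gamma> J T (l(x := y + 1)) (h(x := y + 1))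
        * box_weight \<gamma> J T (l'(x := z - 1)) (h'(x := z - 1)))"
  using assms by (intro box_weight_exchange_aux shift_property_holds) auto

section \<open>From probabilities to box weights\<close>

lemma measure_alloc_measure:
  assumes "\<And>\<sigma>. \<sigma> \<in> allocations m n \<Longrightarrow> weight m \<gamma> \<sigma> \<ge> 0"
  shows "\<P>(\<sigma> in alloc_measure m n \<gamma>. Q \<sigma>) =
    (\<Sum>\<sigma>\<in>allocations m n. of_bool (Q \<sigma>) * weight m \<gamma> \<sigma>) / (\<Sum>\<tau>\<in>allocations m n. weight m \<gamma> \<tau>)"
proof -
  let ?Z = "\<Sum>\<tau>\<in>allocations m n. weight m \<gamma> \<tau>" and ?S = "{\<sigma> \<in> allocations m n. Q \<sigma>}"
  have fin: "finite (allocations m n)"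
    unfolding allocations_def by (rule finite_PiE) auto
  have "?Z \<ge> 0"
    using assms by (rule sum_nonneg)
  have "emeasure (alloc_measure m n \<gamma>) ?S = (\<Sum>\<sigma>\<in>?S. ennreal (weight m \<gamma> \<sigma> / ?Z))"
    unfolding alloc_measure_def using fin by (intro emeasure_point_measure_finite) auto
  also have "\<dots> = ennreal (\<Sum>\<sigma>\<in>?S. weight m \<gamma> \<sigma> / ?Z)"
    using assms \<open>?Z \<ge> 0\<close> by (intro sum_ennreal) auto
  finally have "measure (alloc_measure m n \<gamma>) ?S = (\<Sum>\<sigma>\<in>?S. weight m \<gamma> \<sigma> / ?Z)"
    using assms \<open>?Z \<ge> 0\<close>
    unfolding measure_def by (simp only:) (intro enn2real_ennreal sum_nonneg divide_nonneg_nonneg, auto)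
  also have "\<dots> = (\<Sum>\<sigma>\<in>?S. weight m \<gamma> \<sigma>) / ?Z"
    by (simp add: sum_divide_distrib)
  also have "(\<Sum>\<sigma>\<in>?S. weight m \<gamma> \<sigma>) = (\<Sum>\<sigma>\<in>allocations m n. of_bool (Q \<sigma>) * weight m \<gamma> \<sigma>)"
    by (rule sum.mono_neutral_cong_left) (use fin in auto)
  finally show ?thesis
    by (simp add: alloc_measure_def space_point_measure)
qed

text \<open>This is the unnormalized joint probability of \<open>k\<close> balls in urn
  \<open>n\<close> and the box event; equal lower and upper bounds pin that urn.\<close>

definition urn_weight ::
  "nat \<Rightarrow> nat \<Rightarrow> (nat \<Rightarrow> nat \<Rightarrow> real) \<Rightarrow> (nat \<Rightarrow> nat) \<Rightarrow> (nat \<Rightarrow> nat) \<Rightarrow> nat \<Rightarrow> real" where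
  "urn_weight m n \<gamma> a b k = box_weight \<gamma> {1..n} {1..m}
     ((\<lambda>j. int (a j))(n := int k)) ((\<lambda>j. int (b j))(n := int k))"

lemma urn_weight_nonneg:
  assumes "\<forall>i\<in>{1..m}. \<forall>j\<in>{1..n}. \<gamma> i j \<ge> 0"
  shows "urn_weight m n \<gamma> a b k \<ge> 0"
  unfolding urn_weight_def using assms by (intro box_weight_nonneg) auto

text \<open>Normalization and conditioning divide by quantities independent of \<open>k\<close>, so
  one constant serves all \<open>k\<close>.\<close>

lemma cond_occ_eq_urn_weight:
  assumes "n \<ge> 1" and nonneg: "\<forall>i\<in>{1..m}. \<forall>j\<in>{1..n}. \<gamma> i j \<ge> 0"
    and "admissible m n \<gamma> a b"
  obtains c where "c > 0" "\<And>k. cond_occ m n \<gamma> k a b = c * urn_weight m n \<gamma> a b k"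
proof
  let ?M = "alloc_measure m n \<gamma>" and ?Z = "\<Sum>\<tau>\<in>allocations m n. weight m \<gamma> \<tau>"
  let ?p = "\<P>(\<sigma> in ?M. box_event m n a b \<sigma>)"
  have w: "weight m \<gamma> \<sigma> \<ge> 0" if "\<sigma> \<in> allocations m n" for \<sigma>
    unfolding weight_def using that nonneg
    by (intro prod_nonneg) (auto simp: allocations_def PiE_iff)
  have prob: "\<P>(\<sigma> in ?M. Q \<sigma>) = (\<Sum>\<sigma>\<in>allocations m n. of_bool (Q \<sigma>) * weight m \<gamma> \<sigma>) / ?Z" for Q
    using w by (rule measure_alloc_measure)
  have "?p > 0"
    using assms(3) by (simp add: admissible_def)
  \<comment> \<open>For \<open>?Z = 0\<close> division by zero would make \<open>?p\<close>
    zero.\<close>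
  then have "?Z \<noteq> 0"
    using prob[of "box_event m n a b"] by auto
  moreover have "?Z \<ge> 0"
    using w by (rule sum_nonneg)
  ultimately show "1 / (?Z * ?p) > 0"
    using \<open>?p > 0\<close> by simp
  fix k
  have "occupation m \<sigma> n = k \<and> box_event m n a b \<sigma> \<longleftrightarrow>
      in_box {1..n} {1..m} ((\<lambda>j. int (a j))(n := int k)) ((\<lambda>j. int (b j))(n := int k)) \<sigma>" for \<sigma>
  proof -
    have "{1..n} = insert n {1..n - 1}"
      using \<open>n \<ge> 1\<close> by auto
    moreover have "j \<noteq> n" if "j \<in> {1..n - 1}" for j
      using that \<open>n \<ge> 1\<close> by auto
    ultimately show ?thesis
      by (auto simp: in_box_def box_event_def occupation_def)
  qed
  then have "\<P>(\<sigma> in ?M. occupation m \<sigma> n = k \<and> box_event m n a b \<sigma>) = urn_weight m n \<gamma> a b k / ?Z"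
    unfolding prob
    by (simp add: urn_weight_def box_weight_def allocations_def weight_def)
  then show "cond_occ m n \<gamma> k a b = 1 / (?Z * ?p) * urn_weight m n \<gamma> a b k"
    by (simp add: cond_occ_def cond_prob_def)
qed

lemma urn_weight_exchange:
  assumes "n \<ge> 1" and nonneg: "\<forall>i\<in>{1..m}. \<forall>j\<in>{1..n}. \<gamma> i j \<ge> 0"
    and "\<forall>j\<in>{1..n - 1}. a j \<le> a' j \<and> b j \<le> b' j" and "k < k'"
  shows "real k' * (urn_weight m n \<gamma> a b k * urn_weight m n \<gamma> a' b' k')
    \<le> real (k + 1) * (urn_weight m n \<gamma> a b (k + 1) * urn_weight m n \<gamma> a' b' (k' - 1))"
proof -
  have "box_le ({1..n} - {n}) (\<lambda>j. int (a j)) (\<lambda>j. int (b j)) (\<lambda>j. int (a' j)) (\<lambda>j. int (b' j))"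
  proof -
    have "{1..n} - {n} = {1..n - 1}"
      using \<open>n \<ge> 1\<close> by auto
    then show ?thesis using assms(3) by (simp add: box_le_def)
  qed
  moreover have "int (k' - 1) = int k' - 1"
    using \<open>k < k'\<close> by simp
  ultimately show ?thesis
    using box_weight_exchange[of "{1..n}" "{1..m}" n \<gamma> "\<lambda>j. int (a j)" "\<lambda>j. int (b j)"
        "\<lambda>j. int (a' j)" "\<lambda>j. int (b' j)" "int k" "int k'"] nonneg \<open>n \<ge> 1\<close> \<open>k < k'\<close>
    by (simp add: urn_weight_def add.commute)
qed

section \<open>Comparison of extended ratios\<close>

text \<open>If \<open>y = 0\<close>, the right side is infinite. If \<open>y > 0\<close>, then
  \<open>y' = 0\<close> would force \<open>x' = 0\<close>, the excluded indeterminate case, so both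
  ratios are real quotients.\<close>

lemma ratio_mono:
  assumes nonneg: "x \<ge> 0" "y \<ge> 0" "x' \<ge> 0" "y' \<ge> 0" and "c > 0"
    and "determinate x y" "determinate x' y'"
    and le: "x' * y \<le> c * (x * y')"
  shows "ratio x' y' \<le> ennreal c * ratio x y"
proof (cases "y = 0")
  case True
  then have "x > 0"
    using assms by (simp add: determinate_def less_le)
  then have "ratio x y = \<infinity>"
    using True ratio_zero_right by simp
  then show ?thesis
    using \<open>c > 0\<close> by (simp add: ennreal_mult_top)
next
  case False
  then have "y > 0" using nonneg by simp
  have "y' > 0"
  proof (rule ccontr)
    assume "\<not> y' > 0"
    then have "y' = 0" using nonneg by simp
    with le have "x' * y \<le> 0" by simp
    with \<open>y > 0\<close> have "x' = 0" using nonneg by (simp add: mult_le_0_iff)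
    with \<open>y' = 0\<close> show False using assms(7) by (simp add: determinate_def)
  qed
  have "x' / y' \<le> c * (x / y)"
    using le \<open>y > 0\<close> \<open>y' > 0\<close> by (simp add: divide_simps mult.assoc)
  then show ?thesis
    using nonneg \<open>y > 0\<close> \<open>y' > 0\<close> \<open>c > 0\<close>
    by (simp add: ratio_def divide_ennreal ennreal_mult[symmetric] ennreal_leI)
qed

theorem theorem4:
  fixes m n :: nat and \<gamma> :: "nat \<Rightarrow> nat \<Rightarrow> real"
  assumes "m \<ge> 1" and "n \<ge> 1"
    and "\<forall>i\<in>{1..m}. \<forall>j\<in>{1..n}. \<gamma> i j \<ge> 0"
    and "(\<Prod>i\<in>{1..m}. \<Sum>j\<in>{1..n}. \<gamma> i j) > 0"
  defines "p \<equiv> cond_occ m n \<gamma>"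
  shows "(\<forall>k a b a' b'.
            admissible m n \<gamma> a b \<longrightarrow> admissible m n \<gamma> a' b' \<longrightarrow>
            (\<forall>j\<in>{1..n - 1}. a j \<le> a' j \<and> b j \<le> b' j) \<longrightarrow>
            determinate (p (k + 1) a b) (p k a b) \<longrightarrow>
            determinate (p (k + 1) a' b') (p k a' b') \<longrightarrow>
            ratio (p (k + 1) a' b') (p k a' b') \<le> ratio (p (k + 1) a b) (p k a b))
       \<and> (\<forall>k\<ge>1. \<forall>a b.
            admissible m n \<gamma> a b \<longrightarrow>
            determinate (p (k + 1) a b) (p k a b) \<longrightarrow>
            determinate (p k a b) (p (k - 1) a b) \<longrightarrow>
            ratio (p (k + 1) a b) (p k a b)
              \<le> ennreal (real k / real (k + 1)) * ratio (p k a b) (p (k - 1) a b))"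
proof (intro conjI allI impI)
  note exchange = urn_weight_exchange[OF assms(2,3)]
  note nonneg = urn_weight_nonneg[OF assms(3)]
  fix k a b a' b'
  assume adm: "admissible m n \<gamma> a b" "admissible m n \<gamma> a' b'"
    and le: "\<forall>j\<in>{1..n - 1}. a j \<le> a' j \<and> b j \<le> b' j"
    and det: "determinate (p (k + 1) a b) (p k a b)" "determinate (p (k + 1) a' b') (p k a' b')"
  obtain c where c: "c > 0" "\<And>k. p k a b = c * urn_weight m n \<gamma> a b k"
    unfolding p_def using cond_occ_eq_urn_weight[OF assms(2,3) adm(1)] by blast
  obtain c' where c': "c' > 0" "\<And>k. p k a' b' = c' * urn_weight m n \<gamma> a' b' k"
    unfolding p_def using cond_occ_eq_urn_weight[OF assms(2,3) adm(2)] by blast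
  \<comment> \<open>With \<open>k' = k + 1\<close> both factors in the exchange inequality equal
    \<open>k + 1\<close> and cancel.\<close>
  have "urn_weight m n \<gamma> a b k * urn_weight m n \<gamma> a' b' (k + 1)
      \<le> urn_weight m n \<gamma> a b (k + 1) * urn_weight m n \<gamma> a' b' k"
    using exchange[OF le, of k "k + 1"] by simp
  then have "(c * c') * (urn_weight m n \<gamma> a b k * urn_weight m n \<gamma> a' b' (k + 1))
      \<le> (c * c') * (urn_weight m n \<gamma> a b (k + 1) * urn_weight m n \<gamma> a' b' k)"
    using c(1) c'(1) by (intro mult_left_mono) auto
  then have "p (k + 1) a' b' * p k a b \<le> 1 * (p (k + 1) a b * p k a' b')"
    unfolding c(2) c'(2) by (simp add: ac_simps)
  then have "ratio (p (k + 1) a' b') (p k a' b') \<le> ennreal 1 * ratio (p (k + 1) a b) (p k a b)"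
    using det nonneg c c' by (intro ratio_mono) simp_all
  then show "ratio (p (k + 1) a' b') (p k a' b') \<le> ratio (p (k + 1) a b) (p k a b)"
    by simp
next
  note exchange = urn_weight_exchange[OF assms(2,3)]
  note nonneg = urn_weight_nonneg[OF assms(3)]
  fix k :: nat and a b
  assume "k \<ge> 1" and adm: "admissible m n \<gamma> a b"
    and det: "determinate (p (k + 1) a b) (p k a b)" "determinate (p k a b) (p (k - 1) a b)"
  obtain c where c: "c > 0" "\<And>k. p k a b = c * urn_weight m n \<gamma> a b k"
    unfolding p_def using cond_occ_eq_urn_weight[OF assms(2,3) adm] by blast
  let ?W = "urn_weight m n \<gamma> a b"
  \<comment> \<open>The two boxes coincide here; the indices \<open>k - 1\<close> and
    \<open>k + 1\<close> meet at \<open>k\<close>, and the factors \<open>k + 1\<close> and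
    \<open>k\<close> produce the constant.\<close>
  have "real (k + 1) * (?W (k - 1) * ?W (k + 1)) \<le> real k * (?W k * ?W k)"
    using exchange[of a a b b "k - 1" "k + 1"] \<open>k \<ge> 1\<close> by simp
  then have "?W (k + 1) * ?W (k - 1) \<le> real k / real (k + 1) * (?W k * ?W k)"
    by (simp add: field_simps)
  then have "(c * c) * (?W (k + 1) * ?W (k - 1)) \<le> (c * c) * (real k / real (k + 1) * (?W k * ?W k))"
    using c(1) by (intro mult_left_mono) auto
  then have "p (k + 1) a b * p (k - 1) a b \<le> real k / real (k + 1) * (p k a b * p k a b)"
    unfolding c(2) by (simp add: ac_simps)
  then show "ratio (p (k + 1) a b) (p k a b)
      \<le> ennreal (real k / real (k + 1)) * ratio (p k a b) (p (k - 1) a b)"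
    using det nonneg c \<open>k \<ge> 1\<close> by (intro ratio_mono) simp_all
qed

end
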